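(* For every integer $n\geq 1$, the $n$-th order $B$-spline $\phi_n$ on the Heisenberg group satisfies $$\int_{\mathbb{R}^3}\phi_n(x,y,t)\,dx\,dy\,dt=(\sqrt{2})^n.$$
   Context: The Heisenberg group $\mathbb{H}$ is $\mathbb{R}^3$ with the group law $(x,y,t)(x',y',t')=(x+x',\,y+y',\,t+t'+\tfrac12(x'y-y'x))$, so that $(x,y,t)^{-1}=(-x,-y,-t)$; Haar measure is Lebesgue measure $dx\,dy\,dt$ on $\mathbb{R}^3$. For $f,g\in L^1(\mathbb{H})$, the convolution is $(f*g)(x,y,t)=\int_{\mathbb{H}}f\big((x,y,t)(u,v,s)^{-1}\big)g(u,v,s)\,du\,dv\,ds$. The $B$-splines on $\mathbb{H}$ are $\phi_1=\frac{1}{\sqrt2}\chi_{[0,2]\times[0,1]\times[0,1]}$ and $\phi_{n+1}=\phi_n*\phi_1$ for $n\ge1$ (so $\phi_n$ is the $n$-fold convolution of $\phi_1$). *)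

theory Defs
  imports "HOL-Analysis.Analysis"
begin

text \<open>The underlying space of the Heisenberg group is \<open>real \<times> real \<times> real\<close>; its Haar measure is
  Lebesgue measure \<^const>\<open>lborel\<close>.\<close>

type_synonym heis = "real \<times> real \<times> real"

fun heis_mult :: "heis \<Rightarrow> heis \<Rightarrow> heis" where
  "heis_mult (x, y, t) (x', y', t') = (x + x', y + y', t + t' + 1/2 * (x' * y - y' * x))"

fun heis_inv :: "heis \<Rightarrow> heis" where
  "heis_inv (x, y, t) = (- x, - y, - t)"

definition heis_conv :: "(heis \<Rightarrow> real) \<Rightarrow> (heis \<Rightarrow> real) \<Rightarrow> heis \<Rightarrow> real" where
  "heis_conv f g p = (\<integral>q. f (heis_mult p (heis_inv q)) * g q \<partial>lborel)"

text \<open>The splines are indexed from 1; the value at 0 is a dummy.\<close>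

fun heis_bspline :: "nat \<Rightarrow> heis \<Rightarrow> real" where
  "heis_bspline 0 = (\<lambda>_. 0)"
| "heis_bspline (Suc 0) = (\<lambda>p. 1 / sqrt 2 * indicator ({0..2} \<times> {0..1} \<times> {0..1}) p)"
| "heis_bspline (Suc (Suc n)) = heis_conv (heis_bspline (Suc n)) (heis_bspline (Suc 0))"

end

theory Submission
  imports Defs
begin

text \<open>Right translations of the Heisenberg group are shears followed by Euclidean translations, so
  they preserve Lebesgue measure. By Fubini the integral is therefore multiplicative under
  convolution, and the first spline has integral \<open>2 / sqrt 2 = sqrt 2\<close>.\<close>

text \<open>Projections in place of pattern matching on triples: a form that the measurability
  prover can decompose.\<close>

lemma heis_mult_eq:
  "heis_mult p q = (fst p + fst q, fst (snd p) + fst (snd q),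
     snd (snd p) + snd (snd q) + 1/2 * (fst q * fst (snd p) - fst (snd q) * fst p))"
  by (cases p; cases q) auto

lemma heis_inv_eq: "heis_inv p = (- fst p, - fst (snd p), - snd (snd p))"
  by (cases p) auto

lemma measurable_heis_mult [measurable]:
  assumes "f \<in> borel_measurable M" "g \<in> borel_measurable M"
  shows "(\<lambda>x. heis_mult (f x) (g x)) \<in> borel_measurable M"
  using assms unfolding heis_mult_eq borel_prod [symmetric] by measurable

lemma measurable_heis_inv [measurable]:
  assumes "f \<in> borel_measurable M"
  shows "(\<lambda>x. heis_inv (f x)) \<in> borel_measurable M"
  using assms unfolding heis_inv_eq borel_prod [symmetric] by measurable

text \<open>Tonelli applied twice. The variable \<open>t\<close> is innermost because the group law
  twists \<open>t\<close> by an amount depending on \<open>x\<close> and \<open>y\<close>.\<close>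

lemma nn_integral_lborel_triple:
  fixes f :: "real \<times> real \<times> real \<Rightarrow> ennreal"
  assumes [measurable]: "f \<in> borel_measurable borel"
  shows "(\<integral>\<^sup>+p. f p \<partial>lborel) = (\<integral>\<^sup>+x. \<integral>\<^sup>+y. \<integral>\<^sup>+t. f (x, y, t) \<partial>lborel \<partial>lborel \<partial>lborel)"
proof -
  have "(\<integral>\<^sup>+p. f p \<partial>lborel) = (\<integral>\<^sup>+x. \<integral>\<^sup>+q. f (x, q) \<partial>lborel \<partial>lborel)"
    by (subst lborel_prod [symmetric], subst lborel.nn_integral_fst [symmetric])
      (simp_all add: lborel_prod)
  also have "\<dots> = (\<integral>\<^sup>+x. \<integral>\<^sup>+y. \<integral>\<^sup>+t. f (x, y, t) \<partial>lborel \<partial>lborel \<partial>lborel)"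
    by (rule nn_integral_cong, subst lborel_prod [symmetric], subst lborel.nn_integral_fst [symmetric])
      (simp_all add: lborel_prod)
  finally show ?thesis .
qed

lemma nn_integral_lborel_translation:
  fixes f :: "real \<Rightarrow> ennreal"
  assumes [measurable]: "f \<in> borel_measurable borel"
  shows "(\<integral>\<^sup>+x. f (x + a) \<partial>lborel) = (\<integral>\<^sup>+x. f x \<partial>lborel)"
  using nn_integral_real_affine [of f 1 a] by (simp add: add.commute)

lemma nn_integral_heis_mult_right:
  assumes [measurable]: "f \<in> borel_measurable borel"
  shows "(\<integral>\<^sup>+p. f (heis_mult p r) \<partial>lborel) = (\<integral>\<^sup>+p. f p \<partial>lborel)"
proof -
  obtain a b c where r: "r = (a, b, c)" by (cases r)
  have "(\<integral>\<^sup>+p. f (heis_mult p r) \<partial>lborel) =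
      (\<integral>\<^sup>+x. \<integral>\<^sup>+y. \<integral>\<^sup>+t. f (x + a, y + b, t + (c + 1/2 * (a * y - b * x))) \<partial>lborel \<partial>lborel \<partial>lborel)"
    by (subst nn_integral_lborel_triple) (simp_all add: r add.assoc)
  \<comment> \<open>With \<open>x\<close> and \<open>y\<close> fixed, the twist is a constant shift
    of \<open>t\<close>. Once it is absorbed, the shifts of \<open>y\<close> and then
    \<open>x\<close> are plain translations.\<close>
  also have "\<dots> = (\<integral>\<^sup>+x. \<integral>\<^sup>+y. \<integral>\<^sup>+t. f (x + a, y + b, t) \<partial>lborel \<partial>lborel \<partial>lborel)"
    by (intro nn_integral_cong
        nn_integral_lborel_translation [of "\<lambda>t. f (_, _, t)"]) measurable
  also have "\<dots> = (\<integral>\<^sup>+x. \<integral>\<^sup>+y. \<integral>\<^sup>+t. f (x + a, y, t) \<partial>lborel \<partial>lborel \<partial>lborel)"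
    by (intro nn_integral_cong
        nn_integral_lborel_translation [of "\<lambda>y. \<integral>\<^sup>+t. f (_, y, t) \<partial>lborel"]) measurable
  also have "\<dots> = (\<integral>\<^sup>+x. \<integral>\<^sup>+y. \<integral>\<^sup>+t. f (x, y, t) \<partial>lborel \<partial>lborel \<partial>lborel)"
    by (intro nn_integral_lborel_translation
        [of "\<lambda>x. \<integral>\<^sup>+y. \<integral>\<^sup>+t. f (x, y, t) \<partial>lborel \<partial>lborel"]) measurable
  also have "\<dots> = (\<integral>\<^sup>+p. f p \<partial>lborel)"
    by (subst nn_integral_lborel_triple) simp_all
  finally show ?thesis .
qed

text \<open>Invariance stated as an equality of measures, obtained from indicator functions, carries
  over to Bochner integrals and integrability of functions of any sign.\<close>

lemma distr_heis_mult_right: "distr lborel lborel (\<lambda>p. heis_mult p r) = lborel"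
proof (rule measure_eqI)
  fix A assume "A \<in> sets (distr lborel lborel (\<lambda>p. heis_mult p r))"
  then have [measurable]: "A \<in> sets borel" by simp
  have "emeasure (distr lborel lborel (\<lambda>p. heis_mult p r)) A =
      (\<integral>\<^sup>+p. indicator A p \<partial>distr lborel lborel (\<lambda>p. heis_mult p r))"
    by simp
  also have "\<dots> = (\<integral>\<^sup>+p. indicator A (heis_mult p r) \<partial>lborel)"
    by (rule nn_integral_distr) simp_all
  also have "\<dots> = emeasure lborel A"
    by (subst nn_integral_heis_mult_right) simp_all
  finally show "emeasure (distr lborel lborel (\<lambda>p. heis_mult p r)) A = emeasure lborel A" .
qed simp

lemma integral_heis_mult_right:
  fixes f :: "heis \<Rightarrow> real"
  assumes "f \<in> borel_measurable borel"
  shows "(\<integral>p. f (heis_mult p r) \<partial>lborel) = (\<integral>p. f p \<partial>lborel)"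
  using integral_distr [of "\<lambda>p. heis_mult p r" lborel lborel f] assms
  by (simp add: distr_heis_mult_right)

lemma integrable_heis_mult_right:
  fixes f :: "heis \<Rightarrow> real"
  assumes "integrable lborel f"
  shows "integrable lborel (\<lambda>p. f (heis_mult p r))"
  using integrable_distr [of "\<lambda>p. heis_mult p r" lborel lborel f] assms
  by (simp add: distr_heis_mult_right)

text \<open>Both claims rest on integrability of one kernel on the product space, so they are proved
  together.\<close>

lemma heis_conv_integrable_integral:
  assumes f: "integrable lborel f" and g: "integrable lborel g"
  shows integrable_heis_conv: "integrable lborel (heis_conv f g)"
    and integral_heis_conv:
      "(\<integral>p. heis_conv f g p \<partial>lborel) = (\<integral>p. f p \<partial>lborel) * (\<integral>p. g p \<partial>lborel)"
proof -
  have [measurable]: "f \<in> borel_measurable borel" "g \<in> borel_measurable borel"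
    using borel_measurable_integrable [OF f] borel_measurable_integrable [OF g] by simp_all
  \<comment> \<open>With \<open>q\<close> as first argument, the inner integral runs over
    \<open>p\<close>, where \<open>K q\<close> is a right translate of \<open>f\<close> by
    \<open>heis_inv q\<close>, scaled by \<open>g q\<close>.\<close>
  define K where "K q p = f (heis_mult p (heis_inv q)) * g q" for q p
  \<comment> \<open>As a function of \<open>q\<close> this is a constant multiple of the absolute
    value of \<open>g\<close>, which is the bound that Fubini asks for.\<close>
  have norm_K: "(\<integral>p. norm (K q p) \<partial>lborel) = (\<integral>p. \<bar>f p\<bar> \<partial>lborel) * \<bar>g q\<bar>" for q
    using integral_heis_mult_right [of "\<lambda>p. \<bar>f p\<bar>" "heis_inv q"] by (simp add: K_def abs_mult)
  have int_K: "integrable (lborel \<Otimes>\<^sub>M lborel) (\<lambda>(q, p). K q p)"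
  proof (rule lborel_pair.Fubini_integrable)
    show "(\<lambda>(q, p). K q p) \<in> borel_measurable (lborel \<Otimes>\<^sub>M lborel)"
      unfolding K_def by measurable
    show "integrable lborel (\<lambda>q. \<integral>p. norm (case (q, p) of (q, p) \<Rightarrow> K q p) \<partial>lborel)"
      using g by (simp add: norm_K del: real_norm_def)
    show "AE q in lborel. integrable lborel (\<lambda>p. case (q, p) of (q, p) \<Rightarrow> K q p)"
      using integrable_heis_mult_right [OF f] by (simp add: K_def)
  qed
  have conv: "heis_conv f g = (\<lambda>p. \<integral>q. K q p \<partial>lborel)"
    by (simp add: fun_eq_iff heis_conv_def K_def)
  show "integrable lborel (heis_conv f g)"
    unfolding conv by (rule lborel_pair.integrable_snd [OF int_K])
  have "(\<integral>p. heis_conv f g p \<partial>lborel) = (\<integral>q. \<integral>p. K q p \<partial>lborel \<partial>lborel)"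
    unfolding conv by (rule lborel_pair.Fubini_integral [OF int_K])
  then show "(\<integral>p. heis_conv f g p \<partial>lborel) = (\<integral>p. f p \<partial>lborel) * (\<integral>p. g p \<partial>lborel)"
    by (simp add: K_def integral_heis_mult_right)
qed

lemma heis_bspline_1_integrable_integral:
  shows integrable_heis_bspline_1: "integrable lborel (heis_bspline (Suc 0))"
    and integral_heis_bspline_1: "(\<integral>p. heis_bspline (Suc 0) p \<partial>lborel) = sqrt 2"
proof -
  \<comment> \<open>As a \<open>cbox\<close>, the support has volume 2 * 1 * 1 by the product
    formula for content.\<close>
  have box: "{0..2} \<times> {0..1} \<times> {0..1} = cbox (0, 0, 0) (2 :: real, 1 :: real, 1 :: real)"
    by (simp add: cbox_Pair_eq)
  have "measure lborel (cbox (0, 0, 0) (2 :: real, 1 :: real, 1 :: real)) = (2::real)"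
    by (simp add: content_Pair)
  then show "(\<integral>p. heis_bspline (Suc 0) p \<partial>lborel) = sqrt 2"
    by (simp add: box real_div_sqrt)
  show "integrable lborel (heis_bspline (Suc 0))"
    by (auto simp: box intro!: integrable_divide
        integrable_real_indicator [OF _ emeasure_lborel_cbox_finite])
qed

theorem theorem3p2:
  fixes n :: nat
  assumes "n \<ge> 1"
  shows "(\<integral>p. heis_bspline n p \<partial>lborel) = sqrt 2 ^ n"
proof -
  \<comment> \<open>Integrability joins the induction claim because
    \<open>integral_heis_conv\<close> requires it of both factors.\<close>
  have "integrable lborel (heis_bspline n) \<and> (\<integral>p. heis_bspline n p \<partial>lborel) = sqrt 2 ^ n"
    using assms
  proof (induction n rule: nat_induct_at_least)
    case base
    show ?case
      using heis_bspline_1_integrable_integral by (simp del: heis_bspline.simps)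
  next
    case (Suc n)
    \<comment> \<open>The defining recursion starts at \<open>Suc (Suc n)\<close>; the bound on
      \<open>n\<close> excludes the dummy spline at 0.\<close>
    from \<open>1 \<le> n\<close> have "heis_bspline (Suc n) = heis_conv (heis_bspline n) (heis_bspline (Suc 0))"
      by (cases n) simp_all
    with Suc.IH heis_bspline_1_integrable_integral show ?case
      by (simp add: heis_conv_integrable_integral del: heis_bspline.simps)
  qed
  then show ?thesis ..
qed

end
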